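(* Let $(r_n)_{n\geq 1}$ be a sequence of positive real numbers such that $\frac{-\log r_n}{n}\to\infty$ as $n\to\infty$. Then the topology $\sigma_{(r_n)}$ on $\mathbb{R}$ is a Hausdorff topological Vector Group (TVG) topology, and \[ t\subsetneq\sigma_{(r_n)}\subsetneq\tau_{\mathrm{usual}}, \] where $\tau_{\mathrm{usual}}$ is the usual topology on $\mathbb{R}$ and topologies are compared by inclusion of their families of open sets.
   Context: A topological Vector Group (TVG) topology on a real vector space is a group topology (for addition) such that, for each fixed real scalar $c$, the map $x\mapsto cx$ is continuous; joint continuity of scalar multiplication is not required. Here the real vector space is $\mathbb{R}$. For $x\in\mathbb{R}$ write $\|x\|_{\mathbb{T}}=\operatorname{dist}(x,\mathbb{Z})=\inf_{m\in\mathbb{Z}}|x-m|$. The topology $t$ on $\mathbb{R}$ is the translation-invariant topology for which the sets \[ T(F,\varepsilon)=\{x\in\mathbb{R}:\|\lambda x\|_{\mathbb{T}}<\varepsilon\text{ for every }\lambda\in F\}, \] with $F\subset\mathbb{R}\setminus\{0\}$ finite nonempty and $\varepsilon>0$, form a neighborhood base at zero. For a sequence $(r_n)_{n\ge1}$ of positive reals and a finite nonempty set $A\subset\mathbb{R}\setminus\{0\}$, put \[ p_A(x)=\sup_{a\in A,\ n\geq1}\|a r_n x\|_{\mathbb{T}},\qquad U(A,\varepsilon)=\{x\in\mathbb{R}:p_A(x)<\varepsilon\}\quad(\varepsilon>0). \] The topology $\sigma_{(r_n)}$ is the translation-invariant topology on $\mathbb{R}$ generated by the sets $U(A,\varepsilon)$,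 i.e. the topology for which these sets (over all finite nonempty $A\subset\mathbb{R}\setminus\{0\}$ and all $\varepsilon>0$) form a neighborhood base at zero. *)

theory Defs
  imports "HOL-Analysis.Analysis"
begin

definition TVG_topology :: "'a::real_vector topology \<Rightarrow> bool" where
  "TVG_topology T \<longleftrightarrow>
     topspace T = UNIV \<and>
     continuous_map (prod_topology T T) T (\<lambda>(x, y). x + y) \<and>
     continuous_map T T uminus \<and>
     (\<forall>c. continuous_map T T (\<lambda>x. c *\<^sub>R x))"

(* The translation-invariant topology with neighbourhood base B at zero.  The predicate below is
   an honest topology when B is nonempty and directed downwards, and the members of B really are
   neighbourhoods of zero when, moreover, every N in B contains 0 and some M + M with M in B; for
   the two families used here this is established at the end of the theory. *)
definition translation_topology :: "'a::ab_group_add set set \<Rightarrow> 'a topology" where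
  "translation_topology B = topology (\<lambda>S. \<forall>x\<in>S. \<exists>N\<in>B. (+) x ` N \<subseteq> S)"

definition torus_norm :: "real \<Rightarrow> real" where
  "torus_norm x = infdist x \<int>"

definition T_nbhd :: "real set \<Rightarrow> real \<Rightarrow> real set" where
  "T_nbhd F \<epsilon> = {x. \<forall>l\<in>F. torus_norm (l * x) < \<epsilon>}"

definition t_topology :: "real topology" where
  "t_topology = translation_topology
     {T_nbhd F \<epsilon> | F \<epsilon>. finite F \<and> F \<noteq> {} \<and> 0 \<notin> F \<and> \<epsilon> > 0}"

(* Sequences start at index 1; the value r 0 is never used.  The supremum is over a nonempty set
   of reals in [0, 1/2], so the conditionally complete SUP is the true supremum. *)
definition p_seminorm :: "(nat \<Rightarrow> real) \<Rightarrow> real set \<Rightarrow> real \<Rightarrow> real" where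
  "p_seminorm r A x = (SUP (a, n)\<in>A \<times> {1..}. torus_norm (a * r n * x))"

definition U_nbhd :: "(nat \<Rightarrow> real) \<Rightarrow> real set \<Rightarrow> real \<Rightarrow> real set" where
  "U_nbhd r A \<epsilon> = {x. p_seminorm r A x < \<epsilon>}"

definition sigma_topology :: "(nat \<Rightarrow> real) \<Rightarrow> real topology" where
  "sigma_topology r = translation_topology
     {U_nbhd r A \<epsilon> | A \<epsilon>. finite A \<and> A \<noteq> {} \<and> 0 \<notin> A \<and> \<epsilon> > 0}"


lemma openin_translation_topology:
  assumes "B \<noteq> {}" and dir: "\<And>M N. M \<in> B \<Longrightarrow> N \<in> B \<Longrightarrow> \<exists>K\<in>B. K \<subseteq> M \<inter> N"
  shows "openin (translation_topology B) S \<longleftrightarrow> (\<forall>x\<in>S. \<exists>N\<in>B. (+) x ` N \<subseteq> S)"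
proof -
  have "istopology (\<lambda>S. \<forall>x\<in>S. \<exists>N\<in>B. (+) x ` N \<subseteq> S)"
    unfolding istopology_def
  proof (intro conjI allI impI ballI)
    fix S T x
    assume S: "\<forall>x\<in>S. \<exists>N\<in>B. (+) x ` N \<subseteq> S" and T: "\<forall>x\<in>T. \<exists>N\<in>B. (+) x ` N \<subseteq> T"
      and x: "x \<in> S \<inter> T"
    obtain M N where MN: "M \<in> B" "N \<in> B" "(+) x ` M \<subseteq> S" "(+) x ` N \<subseteq> T"
      using S T x by blast
    then obtain K where "K \<in> B" "K \<subseteq> M \<inter> N" using dir by blast
    then show "\<exists>N\<in>B. (+) x ` N \<subseteq> S \<inter> T" using MN by blast
  next
    fix \<K> x
    assume "\<forall>K\<in>\<K>. \<forall>x\<in>K. \<exists>N\<in>B. (+) x ` N \<subseteq> K" and "x \<in> \<Union>\<K>"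
    then show "\<exists>N\<in>B. (+) x ` N \<subseteq> \<Union>\<K>" by (meson Sup_upper UnionE subset_trans)
  qed
  then show ?thesis unfolding translation_topology_def by (simp add: topology_inverse')
qed

lemma translation_topology_nbhd_base:
  assumes ne: "B \<noteq> {}" and dir: "\<And>M N. M \<in> B \<Longrightarrow> N \<in> B \<Longrightarrow> \<exists>K\<in>B. K \<subseteq> M \<inter> N"
    and zero: "\<And>N. N \<in> B \<Longrightarrow> 0 \<in> N"
    and half: "\<And>N. N \<in> B \<Longrightarrow> \<exists>M\<in>B. \<forall>x\<in>M. \<forall>y\<in>M. x + y \<in> N"
  shows "(\<exists>S. openin (translation_topology B) S \<and> x \<in> S \<and> S \<subseteq> W) \<longleftrightarrow> (\<exists>N\<in>B. (+) x ` N \<subseteq> W)"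
proof
  assume "\<exists>S. openin (translation_topology B) S \<and> x \<in> S \<and> S \<subseteq> W"
  then obtain S where S: "openin (translation_topology B) S" "x \<in> S" "S \<subseteq> W" by blast
  then obtain N where "N \<in> B" "(+) x ` N \<subseteq> S"
    using openin_translation_topology[OF ne dir] by blast
  then show "\<exists>N\<in>B. (+) x ` N \<subseteq> W" using S by blast
next
  assume "\<exists>N\<in>B. (+) x ` N \<subseteq> W"
  then obtain N where N: "N \<in> B" "(+) x ` N \<subseteq> W" by blast
  define S where "S = {y. \<exists>M\<in>B. (+) y ` M \<subseteq> W}"
  have "\<exists>K\<in>B. (+) y ` K \<subseteq> S" if y: "y \<in> S" for y
  proof -
    obtain M where M: "M \<in> B" "(+) y ` M \<subseteq> W" using y unfolding S_def by blast
    obtain K where K: "K \<in> B" "\<forall>u\<in>K. \<forall>v\<in>K. u + v \<in> M" using half[OF M(1)] by blast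
    have "(+) (y + u) ` K \<subseteq> W" if "u \<in> K" for u
      using K M that by (auto simp: image_subset_iff add.assoc)
    then have "(+) y ` K \<subseteq> S" using K(1) unfolding S_def by blast
    then show ?thesis using K(1) by blast
  qed
  then have "openin (translation_topology B) S"
    using openin_translation_topology[OF ne dir] by blast
  moreover have "x \<in> S" using N unfolding S_def by blast
  moreover have "S \<subseteq> W"
  proof
    fix y assume "y \<in> S"
    then obtain M where "M \<in> B" "(+) y ` M \<subseteq> W" unfolding S_def by blast
    then have "y + 0 \<in> W" using zero by (metis image_subset_iff)
    then show "y \<in> W" by simp
  qed
  ultimately show "\<exists>S. openin (translation_topology B) S \<and> x \<in> S \<and> S \<subseteq> W" by blast
qed

lemma torus_norm_nonneg: "0 \<le> torus_norm x"
  unfolding torus_norm_def by (rule infdist_nonneg)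

lemma torus_norm_le_abs: "m \<in> \<int> \<Longrightarrow> torus_norm x \<le> \<bar>x - m\<bar>"
  unfolding torus_norm_def using infdist_le[of m \<int> x] by (simp add: dist_real_def)

lemma torus_norm_0 [simp]: "torus_norm 0 = 0"
  unfolding torus_norm_def by simp

lemma torus_norm_attained: "\<exists>m\<in>\<int>. torus_norm x = \<bar>x - m\<bar>"
proof -
  have "closed (\<int> :: real set)" "(\<int> :: real set) \<noteq> {}" by auto
  then obtain m where "m \<in> (\<int> :: real set)" "infdist x \<int> = dist x m"
    using infdist_attains_inf[of \<int> x] by blast
  then show ?thesis unfolding torus_norm_def dist_real_def by blast
qed

lemma torus_norm_add: "torus_norm (x + y) \<le> torus_norm x + torus_norm y"
proof -
  obtain m n where "m \<in> \<int>" "torus_norm x = \<bar>x - m\<bar>" "n \<in> \<int>" "torus_norm y = \<bar>y - n\<bar>"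
    using torus_norm_attained by meson
  then show ?thesis using torus_norm_le_abs[of "m + n" "x + y"] by auto
qed

lemma torus_norm_le_half: "torus_norm x \<le> 1/2"
  using torus_norm_le_abs[of "of_int (round x)" x] of_int_round_abs_le[of x]
  by (simp add: abs_minus_commute)

lemma p_seminorm_bdd: "bdd_above ((\<lambda>(a, n). torus_norm (a * r n * x)) ` (A \<times> {1..}))"
  by (rule bdd_aboveI[of _ "1/2"]) (use torus_norm_le_half in fastforce)

lemma p_seminorm_upper:
  "a \<in> A \<Longrightarrow> n \<ge> 1 \<Longrightarrow> torus_norm (a * r n * x) \<le> p_seminorm r A x"
  unfolding p_seminorm_def using cSUP_upper[OF _ p_seminorm_bdd, of "(a, n)" A r x] by simp

lemma p_seminorm_least:
  assumes "A \<noteq> {}" "\<And>a n. a \<in> A \<Longrightarrow> n \<ge> 1 \<Longrightarrow> torus_norm (a * r n * x) \<le> c"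
  shows "p_seminorm r A x \<le> c"
proof -
  have "A \<times> {1::nat..} \<noteq> {}" using assms(1) by auto
  then show ?thesis unfolding p_seminorm_def using assms(2) by (intro cSUP_least) auto
qed

lemma t_topology_nbhd_base:
  "(\<exists>S. openin t_topology S \<and> x \<in> S \<and> S \<subseteq> W) \<longleftrightarrow>
   (\<exists>F \<epsilon>. finite F \<and> F \<noteq> {} \<and> 0 \<notin> F \<and> \<epsilon> > 0 \<and> (+) x ` T_nbhd F \<epsilon> \<subseteq> W)"
proof -
  let ?B = "{T_nbhd F \<epsilon> | F \<epsilon>. finite F \<and> F \<noteq> {} \<and> 0 \<notin> F \<and> \<epsilon> > 0}"
  have mem: "T_nbhd F \<epsilon> \<in> ?B" if "finite F" "F \<noteq> {}" "0 \<notin> F" "\<epsilon> > 0" for F \<epsilon>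
    using that by blast
  have "T_nbhd {1} 1 \<in> ?B" by (rule mem) simp_all
  then have ne: "?B \<noteq> {}" by blast
  have dir: "\<exists>K\<in>?B. K \<subseteq> M \<inter> N" if M: "M \<in> ?B" and N: "N \<in> ?B" for M N
  proof -
    obtain F \<epsilon> G \<delta> where *: "M = T_nbhd F \<epsilon>" "finite F" "F \<noteq> {}" "0 \<notin> F" "\<epsilon> > 0"
      "N = T_nbhd G \<delta>" "finite G" "0 \<notin> G" "\<delta> > 0" using M N by auto
    have "T_nbhd (F \<union> G) (min \<epsilon> \<delta>) \<in> ?B" by (rule mem) (use * in auto)
    moreover have "T_nbhd (F \<union> G) (min \<epsilon> \<delta>) \<subseteq> M \<inter> N" unfolding * T_nbhd_def by auto
    ultimately show ?thesis by blast
  qed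
  have zero: "0 \<in> N" if "N \<in> ?B" for N using that by (auto simp: T_nbhd_def)
  have half: "\<exists>M\<in>?B. \<forall>x\<in>M. \<forall>y\<in>M. x + y \<in> N" if N: "N \<in> ?B" for N
  proof -
    obtain F \<epsilon> where *: "N = T_nbhd F \<epsilon>" "finite F" "F \<noteq> {}" "0 \<notin> F" "\<epsilon> > 0" using N by blast
    have "T_nbhd F (\<epsilon>/2) \<in> ?B" by (rule mem) (use * in auto)
    moreover have "u + v \<in> N" if "u \<in> T_nbhd F (\<epsilon>/2)" "v \<in> T_nbhd F (\<epsilon>/2)" for u v
      unfolding * T_nbhd_def
    proof (intro CollectI ballI)
      fix l assume "l \<in> F"
      then have "torus_norm (l * u) < \<epsilon>/2" "torus_norm (l * v) < \<epsilon>/2"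
        using that by (auto simp: T_nbhd_def)
      then show "torus_norm (l * (u + v)) < \<epsilon>"
        using torus_norm_add[of "l * u" "l * v"] by (simp add: distrib_left)
    qed
    ultimately show ?thesis by blast
  qed
  have "(\<exists>N\<in>?B. Q N) \<longleftrightarrow>
      (\<exists>F \<epsilon>. finite F \<and> F \<noteq> {} \<and> 0 \<notin> F \<and> \<epsilon> > 0 \<and> Q (T_nbhd F \<epsilon>))" for Q
    by blast
  moreover have "(\<exists>S. openin (translation_topology ?B) S \<and> x \<in> S \<and> S \<subseteq> W) \<longleftrightarrow>
      (\<exists>N\<in>?B. (+) x ` N \<subseteq> W)"
    by (rule translation_topology_nbhd_base) (fact ne dir zero half)+
  ultimately show ?thesis unfolding t_topology_def by (rule trans[rotated])
qed

lemma sigma_topology_nbhd_base: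
  "(\<exists>S. openin (sigma_topology r) S \<and> x \<in> S \<and> S \<subseteq> W) \<longleftrightarrow>
   (\<exists>A \<epsilon>. finite A \<and> A \<noteq> {} \<and> 0 \<notin> A \<and> \<epsilon> > 0 \<and> (+) x ` U_nbhd r A \<epsilon> \<subseteq> W)"
proof -
  let ?B = "{U_nbhd r A \<epsilon> | A \<epsilon>. finite A \<and> A \<noteq> {} \<and> 0 \<notin> A \<and> \<epsilon> > 0}"
  have mem: "U_nbhd r A \<epsilon> \<in> ?B" if "finite A" "A \<noteq> {}" "0 \<notin> A" "\<epsilon> > 0" for A \<epsilon>
    using that by blast
  have "U_nbhd r {1} 1 \<in> ?B" by (rule mem) simp_all
  then have ne: "?B \<noteq> {}" by blast
  have mono: "p_seminorm r A y \<le> p_seminorm r C y" if "A \<noteq> {}" "A \<subseteq> C" for A C y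
    using that by (intro p_seminorm_least p_seminorm_upper) auto
  have dir: "\<exists>K\<in>?B. K \<subseteq> M \<inter> N" if M: "M \<in> ?B" and N: "N \<in> ?B" for M N
  proof -
    obtain A \<epsilon> C \<delta> where *: "M = U_nbhd r A \<epsilon>" "finite A" "A \<noteq> {}" "0 \<notin> A" "\<epsilon> > 0"
      "N = U_nbhd r C \<delta>" "finite C" "C \<noteq> {}" "0 \<notin> C" "\<delta> > 0" using M N by blast
    have "U_nbhd r (A \<union> C) (min \<epsilon> \<delta>) \<in> ?B" by (rule mem) (use * in auto)
    moreover have "U_nbhd r (A \<union> C) (min \<epsilon> \<delta>) \<subseteq> M \<inter> N"
      unfolding * U_nbhd_def using mono[of A "A \<union> C"] mono[of C "A \<union> C"] *(3,8)
      by (auto intro: le_less_trans)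
    ultimately show ?thesis by blast
  qed
  have zero: "0 \<in> N" if N: "N \<in> ?B" for N
  proof -
    obtain A \<epsilon> where *: "N = U_nbhd r A \<epsilon>" "A \<noteq> {}" "\<epsilon> > 0" using N by blast
    have "p_seminorm r A 0 \<le> 0" using *(2) by (intro p_seminorm_least) auto
    then show ?thesis using * by (simp add: U_nbhd_def)
  qed
  have half: "\<exists>M\<in>?B. \<forall>x\<in>M. \<forall>y\<in>M. x + y \<in> N" if N: "N \<in> ?B" for N
  proof -
    obtain A \<epsilon> where *: "N = U_nbhd r A \<epsilon>" "finite A" "A \<noteq> {}" "0 \<notin> A" "\<epsilon> > 0" using N by blast
    have "U_nbhd r A (\<epsilon>/2) \<in> ?B" by (rule mem) (use * in auto)
    moreover have "u + v \<in> N" if uv: "u \<in> U_nbhd r A (\<epsilon>/2)" "v \<in> U_nbhd r A (\<epsilon>/2)" for u v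
    proof -
      have "p_seminorm r A (u + v) \<le> p_seminorm r A u + p_seminorm r A v"
      proof (rule p_seminorm_least[OF *(3)])
        fix a and n :: nat assume an: "a \<in> A" "n \<ge> 1"
        have "torus_norm (a * r n * (u + v)) \<le> torus_norm (a * r n * u) + torus_norm (a * r n * v)"
          using torus_norm_add[of "a * r n * u" "a * r n * v"] by (simp add: distrib_left)
        then show "torus_norm (a * r n * (u + v)) \<le> p_seminorm r A u + p_seminorm r A v"
          using p_seminorm_upper[OF an, of r u] p_seminorm_upper[OF an, of r v] by linarith
      qed
      then show ?thesis using uv unfolding * U_nbhd_def by auto
    qed
    ultimately show ?thesis by blast
  qed
  have "(\<exists>N\<in>?B. Q N) \<longleftrightarrow>
      (\<exists>A \<epsilon>. finite A \<and> A \<noteq> {} \<and> 0 \<notin> A \<and> \<epsilon> > 0 \<and> Q (U_nbhd r A \<epsilon>))" for Q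
    by blast
  moreover have "(\<exists>S. openin (translation_topology ?B) S \<and> x \<in> S \<and> S \<subseteq> W) \<longleftrightarrow>
      (\<exists>N\<in>?B. (+) x ` N \<subseteq> W)"
    by (rule translation_topology_nbhd_base) (fact ne dir zero half)+
  ultimately show ?thesis unfolding sigma_topology_def by (rule trans[rotated])
qed

end

theory Submission
  imports Defs "HOL-Real_Asymp.Real_Asymp"
begin

text \<open>The inclusions are routine. Each of them is strict because of a pigeonhole argument.

  Since \<open>t\<close> is totally bounded, every infinite set of reals contains two
  distinct points whose difference lies in a given \<open>T(F, \<epsilon>)\<close>. The neighbourhood \<open>U({1}, 1/4)\<close> fails this: as
  \<open>r\<^sub>n \<rightarrow> 0\<close>, the points \<open>1/(2 r\<^sub>n)\<close> contain an infinite set separated by \<open>1/4\<close> in the seminorm.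

  Every \<open>U(A, \<epsilon>)\<close> contains a positive integer: Dirichlet's theorem, applied to the numbers
  \<open>a r\<^sub>n\<close> with \<open>n \<le> L\<close>, gives \<open>q \<le> N ^ (|A| L)\<close> with all \<open>a r\<^sub>n q\<close> close to integers, and the
  superexponential decay of \<open>r\<close> makes \<open>a r\<^sub>n q\<close> itself small for \<open>n > L\<close>. Hence \<open>(-1, 1)\<close> is not
  a neighbourhood of zero in the sigma topology.\<close>

section \<open>Elementary estimates for the distance to the integers\<close>

lemma torus_norm_uminus [simp]: "torus_norm (- x) = torus_norm x"
proof -
  have "torus_norm (- y) \<le> torus_norm y" for y
    using torus_norm_attained[of y] torus_norm_le_abs[of "- m" "- y" for m] by fastforce
  from this[of x] this[of "- x"] show ?thesis by simp
qed

lemma torus_norm_le_abs_self: "torus_norm x \<le> \<bar>x\<bar>"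
  using torus_norm_le_abs[of 0 x] by simp

lemma torus_norm_half: "torus_norm (1/2) = 1/2"
proof (rule antisym[OF torus_norm_le_half])
  obtain m where "torus_norm (1/2) = \<bar>1/2 - of_int m\<bar>"
    using torus_norm_attained by (metis Ints_cases)
  moreover have "m \<le> 0 \<or> m \<ge> 1" by linarith
  ultimately show "1/2 \<le> torus_norm (1/2)" by (auto simp: abs_if)
qed

section \<open>Openness and neighbourhoods in the two topologies\<close>

lemma openin_t_topology:
  "openin t_topology S \<longleftrightarrow>
   (\<forall>x\<in>S. \<exists>F \<epsilon>. finite F \<and> F \<noteq> {} \<and> 0 \<notin> F \<and> \<epsilon> > 0 \<and> (+) x ` T_nbhd F \<epsilon> \<subseteq> S)"
  unfolding t_topology_nbhd_base[symmetric] by (subst openin_subopen) simp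

lemma openin_sigma_topology:
  "openin (sigma_topology r) S \<longleftrightarrow>
   (\<forall>x\<in>S. \<exists>A \<epsilon>. finite A \<and> A \<noteq> {} \<and> 0 \<notin> A \<and> \<epsilon> > 0 \<and> (+) x ` U_nbhd r A \<epsilon> \<subseteq> S)"
  unfolding sigma_topology_nbhd_base[symmetric] by (subst openin_subopen) simp

lemma openin_t_topologyE:
  assumes "openin t_topology S" "x \<in> S"
  obtains F \<epsilon> where "finite F" "F \<noteq> {}" "0 \<notin> F" "\<epsilon> > 0" "(+) x ` T_nbhd F \<epsilon> \<subseteq> S"
  using bspec[OF iffD1[OF openin_t_topology assms(1)] assms(2)] by (elim exE conjE) rule

lemma openin_sigma_topologyE:
  assumes "openin (sigma_topology r) S" "x \<in> S"
  obtains A \<epsilon> where "finite A" "A \<noteq> {}" "0 \<notin> A" "\<epsilon> > 0" "(+) x ` U_nbhd r A \<epsilon> \<subseteq> S"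
  using bspec[OF iffD1[OF openin_sigma_topology assms(1)] assms(2)] by (elim exE conjE) rule

lemma topspace_sigma_topology [simp]: "topspace (sigma_topology r) = UNIV"
proof -
  have "openin (sigma_topology r) UNIV"
    unfolding openin_sigma_topology
    by (intro ballI exI[of _ "{1::real}"] exI[of _ "1::real"]) simp
  then show ?thesis using openin_subset by blast
qed

text \<open>Provides open sets for the continuity and separation proofs, which can thus work with
  seminorm balls without showing that the balls are themselves open.\<close>

lemma U_nbhd_openin_ex:
  assumes "finite A" "A \<noteq> {}" "0 \<notin> A" "\<epsilon> > 0"
  obtains S where "openin (sigma_topology r) S" "x \<in> S" "S \<subseteq> (+) x ` U_nbhd r A \<epsilon>"
  using assms sigma_topology_nbhd_base[of r x "(+) x ` U_nbhd r A \<epsilon>"] by blast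

section \<open>Group operations, scaling and separation in the sigma topology\<close>

lemma p_seminorm_add:
  assumes "A \<noteq> {}"
  shows "p_seminorm r A (x + y) \<le> p_seminorm r A x + p_seminorm r A y"
proof (rule p_seminorm_least[OF assms])
  fix a and n :: nat assume an: "a \<in> A" "n \<ge> 1"
  show "torus_norm (a * r n * (x + y)) \<le> p_seminorm r A x + p_seminorm r A y"
    using torus_norm_add[of "a * r n * x" "a * r n * y"]
      p_seminorm_upper[OF an, of r x] p_seminorm_upper[OF an, of r y]
    by (simp add: distrib_left)
qed

lemma p_seminorm_uminus [simp]: "p_seminorm r A (- x) = p_seminorm r A x"
  by (simp add: p_seminorm_def)

text \<open>A scalar acting on the point is absorbed into the parameter set. As the base ranges over
  all finite nonempty sets of nonzero parameters, this makes each nonzero scaling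
  continuous.\<close>

lemma p_seminorm_image_mult: "p_seminorm r ((*) c ` A) x = p_seminorm r A (c * x)"
proof -
  have "(\<lambda>(a, n). torus_norm (a * r n * x)) ` (((*) c ` A) \<times> {1..}) =
        (\<lambda>(a, n). torus_norm (a * r n * (c * x))) ` (A \<times> {1..})"
    by (force simp: image_iff mult_ac)
  then show ?thesis unfolding p_seminorm_def by simp
qed

lemma sigma_topology_continuous_scale:
  "continuous_map (sigma_topology r) (sigma_topology r) (\<lambda>x. c * x)"
proof (cases "c = 0")
  \<comment> \<open>The ball for \<open>A\<close> pulls back to a ball for the scaled set, which
    avoids 0 only for nonzero \<open>c\<close>; the scalar 0 gives a constant map.\<close>
  case False
  have "openin (sigma_topology r) {x. c * x \<in> S}" if S: "openin (sigma_topology r) S" for S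
    unfolding openin_sigma_topology
  proof
    fix x assume "x \<in> {x. c * x \<in> S}"
    then have "c * x \<in> S" by simp
    with S obtain A \<epsilon> where A: "finite A" "A \<noteq> {}" "0 \<notin> A" "\<epsilon> > 0"
      "(+) (c * x) ` U_nbhd r A \<epsilon> \<subseteq> S"
      by (rule openin_sigma_topologyE)
    have "(+) x ` U_nbhd r ((*) c ` A) \<epsilon> \<subseteq> {x. c * x \<in> S}"
      using A(5) by (auto simp: U_nbhd_def p_seminorm_image_mult distrib_left)
    moreover have "finite ((*) c ` A)" "(*) c ` A \<noteq> {}" "0 \<notin> (*) c ` A"
      using A False by auto
    ultimately show "\<exists>A \<epsilon>. finite A \<and> A \<noteq> {} \<and> 0 \<notin> A \<and> \<epsilon> > 0 \<and>
        (+) x ` U_nbhd r A \<epsilon> \<subseteq> {x. c * x \<in> S}"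
      using A(4) by blast
  qed
  then show ?thesis by (simp add: continuous_map_def)
qed (simp add: continuous_map_const)

lemma sigma_topology_continuous_add:
  "continuous_map (prod_topology (sigma_topology r) (sigma_topology r)) (sigma_topology r)
     (\<lambda>(x, y). x + y)"
proof -
  have "openin (prod_topology (sigma_topology r) (sigma_topology r)) {z. fst z + snd z \<in> S}"
    if S: "openin (sigma_topology r) S" for S
    unfolding openin_prod_topology_alt
  proof (intro allI impI)
    fix x y assume "(x, y) \<in> {z. fst z + snd z \<in> S}"
    then have "x + y \<in> S" by simp
    with S obtain A \<epsilon> where A: "finite A" "A \<noteq> {}" "0 \<notin> A" "\<epsilon> > 0"
      "(+) (x + y) ` U_nbhd r A \<epsilon> \<subseteq> S"
      by (rule openin_sigma_topologyE)
    obtain U where U: "openin (sigma_topology r) U" "x \<in> U" "U \<subseteq> (+) x ` U_nbhd r A (\<epsilon>/2)"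
      using U_nbhd_openin_ex A(1-4) by (metis half_gt_zero)
    obtain V where V: "openin (sigma_topology r) V" "y \<in> V" "V \<subseteq> (+) y ` U_nbhd r A (\<epsilon>/2)"
      using U_nbhd_openin_ex A(1-4) by (metis half_gt_zero)
    have "x' + y' \<in> S" if xy: "x' \<in> U" "y' \<in> V" for x' y'
    proof -
      obtain u v where uv: "x' = x + u" "y' = y + v" "p_seminorm r A u < \<epsilon>/2" "p_seminorm r A v < \<epsilon>/2"
        using xy U(3) V(3) unfolding U_nbhd_def by blast
      then have "u + v \<in> U_nbhd r A \<epsilon>"
        using p_seminorm_add[OF A(2), of r u v] by (simp add: U_nbhd_def)
      then have "(x + y) + (u + v) \<in> S" using A(5) by blast
      then show ?thesis by (simp add: uv algebra_simps)
    qed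
    then have "U \<times> V \<subseteq> {z. fst z + snd z \<in> S}" by auto
    then show "\<exists>U V. openin (sigma_topology r) U \<and> openin (sigma_topology r) V \<and> x \<in> U \<and> y \<in> V \<and>
        U \<times> V \<subseteq> {z. fst z + snd z \<in> S}"
      using U V by blast
  qed
  then show ?thesis by (simp add: continuous_map_def case_prod_beta)
qed

lemma TVG_sigma_topology: "TVG_topology (sigma_topology r)"
proof -
  have "(uminus :: real \<Rightarrow> real) = (\<lambda>x. -1 * x)" by auto
  then have "continuous_map (sigma_topology r) (sigma_topology r) uminus"
    by (metis sigma_topology_continuous_scale)
  then show ?thesis
    by (simp add: TVG_topology_def sigma_topology_continuous_scale sigma_topology_continuous_add)
qed

text \<open>A single index \<open>n\<close> separates: a suitable parameter \<open>a\<close> sends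
  \<open>x - y\<close> to 1/2, the point of the circle farthest from 0. By the triangle inequality
  the balls of radius 1/4 around \<open>x\<close> and \<open>y\<close> cannot meet.\<close>

lemma Hausdorff_sigma_topology:
  assumes "n \<ge> 1" "r n > 0"
  shows "Hausdorff_space (sigma_topology r)"
  unfolding Hausdorff_space_def
proof (intro allI impI, elim conjE)
  fix x y :: real assume "x \<noteq> y"
  define a where "a = 1 / (2 * r n * (x - y))"
  have a: "a \<noteq> 0" "a * r n * (x - y) = 1/2"
    using \<open>x \<noteq> y\<close> assms by (auto simp: a_def)
  obtain U where U: "openin (sigma_topology r) U" "x \<in> U" "U \<subseteq> (+) x ` U_nbhd r {a} (1/4)"
    using U_nbhd_openin_ex[of "{a}" "1/4" r x] a(1) by auto
  obtain V where V: "openin (sigma_topology r) V" "y \<in> V" "V \<subseteq> (+) y ` U_nbhd r {a} (1/4)"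
    using U_nbhd_openin_ex[of "{a}" "1/4" r y] a(1) by auto
  have False if zUV: "z \<in> U" "z \<in> V" for z
  proof -
    obtain u where u: "z = x + u" "p_seminorm r {a} u < 1/4"
      using subsetD[OF U(3) zUV(1)] unfolding U_nbhd_def by blast
    obtain v where v: "z = y + v" "p_seminorm r {a} v < 1/4"
      using subsetD[OF V(3) zUV(2)] unfolding U_nbhd_def by blast
    have "x - y = v + - u" using u(1) v(1) by simp
    then have "p_seminorm r {a} (x - y) < 1/2"
      using p_seminorm_add[of "{a}" r v "- u"] u(2) v(2) by simp
    then show False
      using p_seminorm_upper[of a "{a}" n r "x - y"] a(2) torus_norm_half assms(1) by simp
  qed
  then show "\<exists>U V. openin (sigma_topology r) U \<and> openin (sigma_topology r) V \<and> x \<in> U \<and> y \<in> V \<and>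
      disjnt U V"
    using U V unfolding disjnt_iff by blast
qed

section \<open>The two inclusions\<close>

text \<open>Dividing each frequency \<open>l\<close> by \<open>r n\<close> makes
  \<open>torus_norm (l * u)\<close> the term of index \<open>n\<close> in the supremum, so the
  seminorm at \<open>A\<close> bounds it.\<close>

lemma t_topology_coarser_sigma:
  assumes "n \<ge> 1" "r n > 0" "openin t_topology S"
  shows "openin (sigma_topology r) S"
  unfolding openin_sigma_topology
proof
  fix x assume "x \<in> S"
  with assms(3) obtain F \<epsilon> where F: "finite F" "F \<noteq> {}" "0 \<notin> F" "\<epsilon> > 0" "(+) x ` T_nbhd F \<epsilon> \<subseteq> S"
    by (rule openin_t_topologyE)
  define A where "A = (\<lambda>l. l / r n) ` F"
  have "U_nbhd r A \<epsilon> \<subseteq> T_nbhd F \<epsilon>"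
  proof
    fix u assume u: "u \<in> U_nbhd r A \<epsilon>"
    have "torus_norm (l * u) < \<epsilon>" if "l \<in> F" for l
      using p_seminorm_upper[of "l / r n" A n r u] that u assms(1,2)
      by (simp add: A_def U_nbhd_def)
    then show "u \<in> T_nbhd F \<epsilon>" by (simp add: T_nbhd_def)
  qed
  moreover have "finite A" "A \<noteq> {}" "0 \<notin> A" using F assms(2) by (auto simp: A_def)
  ultimately show "\<exists>A \<epsilon>. finite A \<and> A \<noteq> {} \<and> 0 \<notin> A \<and> \<epsilon> > 0 \<and> (+) x ` U_nbhd r A \<epsilon> \<subseteq> S"
    using F(4,5) by (meson image_mono subset_trans)
qed

lemma finite_abs_bound:
  assumes "finite (A :: real set)"
  obtains M where "M > 0" "\<And>a. a \<in> A \<Longrightarrow> \<bar>a\<bar> \<le> M"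
  using finite_imp_bounded[OF assms] unfolding bounded_pos by auto

text \<open>A convergent sequence is bounded and \<open>A\<close> is finite, so the seminorm of
  \<open>y - x\<close> is at most \<open>M * R\<close> times the usual distance.\<close>

lemma sigma_topology_coarser_euclidean:
  assumes "r \<longlonglongrightarrow> 0" "openin (sigma_topology r) S"
  shows "open S"
  unfolding open_dist
proof
  fix x assume "x \<in> S"
  with assms(2) obtain A \<epsilon> where A: "finite A" "A \<noteq> {}" "\<epsilon> > 0" "(+) x ` U_nbhd r A \<epsilon> \<subseteq> S"
    by (rule openin_sigma_topologyE)
  obtain M where M: "M > 0" "\<And>a. a \<in> A \<Longrightarrow> \<bar>a\<bar> \<le> M" using finite_abs_bound[OF A(1)] by blast
  obtain R where R: "R > 0" "\<And>n. \<bar>r n\<bar> \<le> R"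
    using convergent_imp_Bseq[of r] assms(1) unfolding convergent_def Bseq_def by auto
  have "y \<in> S" if y: "dist y x < \<epsilon> / (2 * M * R)" for y
  proof -
    \<comment> \<open>A supremum preserves only weak inequalities, so the radius is chosen to reach
      \<epsilon>/2 rather than \<epsilon>.\<close>
    have "p_seminorm r A (y - x) \<le> \<epsilon>/2"
    proof (rule p_seminorm_least[OF A(2)])
      fix a and n :: nat assume "a \<in> A"
      then have "\<bar>a * r n\<bar> * \<bar>y - x\<bar> \<le> (M * R) * (\<epsilon> / (2 * M * R))"
        using M R y unfolding abs_mult by (intro mult_mono) (auto simp: dist_real_def)
      also have "\<dots> = \<epsilon>/2" using M R by simp
      finally show "torus_norm (a * r n * (y - x)) \<le> \<epsilon>/2"
        using torus_norm_le_abs_self[of "a * r n * (y - x)"] by (simp add: abs_mult)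
    qed
    then have "y - x \<in> U_nbhd r A \<epsilon>" using A(3) by (simp add: U_nbhd_def)
    then have "x + (y - x) \<in> S" using A(4) by blast
    then show ?thesis by simp
  qed
  moreover have "\<epsilon> / (2 * M * R) > 0" using A M R by simp
  ultimately show "\<exists>e>0. \<forall>y. dist y x < e \<longrightarrow> y \<in> S" by blast
qed

section \<open>Strictness of the lower inclusion: the infinite pigeonhole principle\<close>

text \<open>Cut the circle into \<open>N\<close> half-open arcs of length \<open>1 / N\<close>. One
  arc contains \<open>l * x\<close> modulo 1 for infinitely many \<open>x\<close> in
  \<open>X\<close>, and fractional parts in one arc differ by less than
  \<open>1 / N\<close>.\<close>

lemma infinite_subset_torus_close:
  fixes X :: "real set"
  assumes "infinite X" "\<epsilon> > 0"
  obtains Y where "Y \<subseteq> X" "infinite Y" "\<And>x y. x \<in> Y \<Longrightarrow> y \<in> Y \<Longrightarrow> torus_norm (l * (x - y)) < \<epsilon>"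
proof -
  obtain N :: nat where N: "N > 0" "1 / real N < \<epsilon>"
    using assms(2) by (metis nat_approx_posE zero_less_Suc)
  define f where "f x = \<lfloor>frac (l * x) * N\<rfloor>" for x
  have "f ` X \<subseteq> {0..int N}"
  proof
    fix k assume "k \<in> f ` X"
    then obtain x where "k = f x" by blast
    moreover have "frac (l * x) * N \<le> 1 * real N"
      by (intro mult_right_mono) (auto intro: less_imp_le[OF frac_lt_1])
    ultimately show "k \<in> {0..int N}"
      unfolding f_def by (auto simp: floor_le_iff)
  qed
  then have "finite (f ` X)" by (rule finite_subset) simp
  then obtain x0 where x0: "x0 \<in> X" "infinite {x \<in> X. f x = f x0}"
    using pigeonhole_infinite[OF assms(1)] by blast
  have "torus_norm (l * (x - y)) < \<epsilon>" if "f x = f y" for x y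
  proof -
    have "\<bar>frac (l * x) * N - frac (l * y) * N\<bar> < 1"
      using that unfolding f_def by linarith
    then have "\<bar>frac (l * x) - frac (l * y)\<bar> * real N < 1"
      by (simp add: abs_mult flip: left_diff_distrib)
    then have "\<bar>frac (l * x) - frac (l * y)\<bar> < 1 / N" using N(1) by (simp add: field_simps)
    moreover have "l * (x - y) - (of_int \<lfloor>l * x\<rfloor> - of_int \<lfloor>l * y\<rfloor>) = frac (l * x) - frac (l * y)"
      by (simp add: frac_def algebra_simps)
    moreover have "torus_norm (l * (x - y)) \<le>
        \<bar>l * (x - y) - (of_int \<lfloor>l * x\<rfloor> - of_int \<lfloor>l * y\<rfloor>)\<bar>"
      by (rule torus_norm_le_abs) auto
    ultimately show ?thesis using N(2) by linarith
  qed
  then show ?thesis by (intro that[OF _ x0(2)]) auto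
qed

text \<open>Frequencies are treated one at a time, each passing to a smaller infinite subset. For
  empty \<open>F\<close> the condition is vacuous and \<open>X\<close> itself serves.\<close>

lemma T_nbhd_infinite_differences:
  assumes "finite F" "\<epsilon> > 0" "infinite X"
  obtains Y where "Y \<subseteq> X" "infinite Y" "\<And>x y. x \<in> Y \<Longrightarrow> y \<in> Y \<Longrightarrow> x - y \<in> T_nbhd F \<epsilon>"
proof -
  have "\<exists>Y\<subseteq>X. infinite Y \<and> (\<forall>x\<in>Y. \<forall>y\<in>Y. x - y \<in> T_nbhd F \<epsilon>)"
    using assms(1)
  proof induction
    case empty
    then show ?case using assms(3) by (auto simp: T_nbhd_def)
  next
    case (insert l F)
    then obtain Y where Y: "Y \<subseteq> X" "infinite Y" "\<forall>x\<in>Y. \<forall>y\<in>Y. x - y \<in> T_nbhd F \<epsilon>" by blast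
    obtain Z where "Z \<subseteq> Y" "infinite Z"
      "\<And>x y. x \<in> Z \<Longrightarrow> y \<in> Z \<Longrightarrow> torus_norm (l * (x - y)) < \<epsilon>"
      using infinite_subset_torus_close[OF Y(2) assms(2), of l] by blast
    with Y have "Z \<subseteq> X \<and> infinite Z \<and> (\<forall>x\<in>Z. \<forall>y\<in>Z. x - y \<in> T_nbhd (insert l F) \<epsilon>)"
      unfolding T_nbhd_def by auto
    then show ?case by blast
  qed
  then show ?thesis using that by blast
qed

text \<open>Along a subsequence \<open>h\<close> on which \<open>r\<close> falls by more than half
  at each step, multiplication by \<open>r (h j)\<close> sends \<open>x j\<close> to 1/2 but every
  earlier \<open>x i\<close> into the interval from 0 to 1/4. So the term of index
  \<open>h j\<close> already separates \<open>x j\<close> from \<open>x i\<close>.\<close>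

lemma infinite_U_separated:
  assumes pos: "\<And>n. n \<ge> 1 \<Longrightarrow> r n > 0" and lim: "r \<longlonglongrightarrow> 0"
  obtains X where "infinite X"
    "\<And>x y. x \<in> X \<Longrightarrow> y \<in> X \<Longrightarrow> x \<noteq> y \<Longrightarrow> x - y \<notin> U_nbhd r {1} (1/4)"
proof -
  have "\<exists>m\<ge>1. r m < r n / 2" if "n \<ge> 1" for n
  proof -
    have "eventually (\<lambda>m. r m < r n / 2 \<and> m \<ge> 1) sequentially"
      using order_tendstoD(2)[OF lim, of "r n / 2"] pos[OF that]
      by (auto intro: eventually_conj eventually_ge_at_top)
    then show ?thesis using eventually_happens'[OF sequentially_bot] by blast
  qed
  then obtain g where g: "\<And>n. n \<ge> 1 \<Longrightarrow> g n \<ge> 1 \<and> r (g n) < r n / 2" by metis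
  \<comment> \<open>Iteration starts at 1 so that all indices stay in the range where positivity and
    the property of \<open>g\<close> are available.\<close>
  define h where "h j = (g ^^ j) 1" for j
  have h1: "h j \<ge> 1" for j
    by (induction j) (use g in \<open>auto simp: h_def\<close>)
  have hS: "r (h (Suc j)) < r (h j) / 2" for j
    using g[OF h1[of j]] by (simp add: h_def)
  have hpos: "r (h j) > 0" for j using pos[OF h1] .
  have hless: "r (h j) < r (h i) / 2" if "i < j" for i j
    using that
  proof (induction j)
    case (Suc j)
    show ?case
    proof (cases "i = j")
      case False
      then show ?thesis using Suc hS[of j] hpos[of j] by simp
    qed (use hS in simp)
  qed simp
  define x where "x j = 1 / (2 * r (h j))" for j
  have sep: "p_seminorm r {1} (x i - x j) \<ge> 1/4 \<and> p_seminorm r {1} (x j - x i) \<ge> 1/4" if "i < j" for i j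
  proof -
    have "r (h j) * x i < 1/4" "r (h j) * x i > 0"
      using hless[OF that] hpos[of i] hpos[of j] by (auto simp: x_def field_simps)
    then have "torus_norm (r (h j) * x i) < 1/4"
      using torus_norm_le_abs_self[of "r (h j) * x i"] by linarith
    moreover have half: "r (h j) * x j = 1/2" using hpos[of j] by (simp add: x_def)
    have "torus_norm (r (h j) * x j) \<le> torus_norm (r (h j) * (x j - x i)) + torus_norm (r (h j) * x i)"
      using torus_norm_add[of "r (h j) * (x j - x i)" "r (h j) * x i"] by (simp add: algebra_simps)
    ultimately have "torus_norm (r (h j) * (x j - x i)) \<ge> 1/4"
      using torus_norm_half unfolding half by linarith
    then have "p_seminorm r {1} (x j - x i) \<ge> 1/4"
      using p_seminorm_upper[of 1 "{1}" "h j" r "x j - x i"] h1[of j] by simp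
    then show ?thesis using p_seminorm_uminus[of r "{1}" "x j - x i"] by simp
  qed
  have xless: "x i < x j" if "i < j" for i j
    using hless[OF that] hpos[of i] hpos[of j] by (simp add: x_def field_simps)
  have "inj x" by (rule injI) (metis xless less_irrefl linorder_neqE_nat)
  then have "infinite (range x)" by (simp add: range_inj_infinite)
  moreover have "u - v \<notin> U_nbhd r {1} (1/4)" if uv: "u \<in> range x" "v \<in> range x" "u \<noteq> v" for u v
  proof -
    obtain i j where ij: "u = x i" "v = x j" using uv by blast
    with uv(3) have "i < j \<or> j < i" by (metis linorder_neqE_nat)
    then show ?thesis using sep[of i j] sep[of j i] ij by (auto simp: U_nbhd_def)
  qed
  ultimately show ?thesis using that by blast
qed

lemma sigma_topology_not_coarser_t:
  assumes "\<And>n. n \<ge> 1 \<Longrightarrow> r n > 0" "r \<longlonglongrightarrow> 0"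
  obtains S where "openin (sigma_topology r) S" "\<not> openin t_topology S"
proof -
  obtain S where S: "openin (sigma_topology r) S" "0 \<in> S" "S \<subseteq> (+) 0 ` U_nbhd r {1} (1/4)"
    using U_nbhd_openin_ex[of "{1}" "1/4" r 0] by auto
  moreover have "\<not> openin t_topology S"
  proof
    assume "openin t_topology S"
    then obtain F \<epsilon> where F: "finite F" "\<epsilon> > 0" "(+) 0 ` T_nbhd F \<epsilon> \<subseteq> S"
      using S(2) by (rule openin_t_topologyE)
    obtain X where X: "infinite X"
      "\<And>x y. x \<in> X \<Longrightarrow> y \<in> X \<Longrightarrow> x \<noteq> y \<Longrightarrow> x - y \<notin> U_nbhd r {1} (1/4)"
      using infinite_U_separated[of r] assms by blast
    obtain Y where Y: "Y \<subseteq> X" "infinite Y" "\<And>x y. x \<in> Y \<Longrightarrow> y \<in> Y \<Longrightarrow> x - y \<in> T_nbhd F \<epsilon>"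
      using T_nbhd_infinite_differences[OF F(1,2) X(1)] by blast
    obtain x where x: "x \<in> Y" using Y(2) by (metis finite.emptyI ex_in_conv)
    have "infinite (Y - {x})" using Y(2) by simp
    then obtain y where "y \<in> Y" "y \<noteq> x" by (metis finite.emptyI ex_in_conv DiffE singletonI)
    then have "x - y \<in> U_nbhd r {1} (1/4)" using Y(3)[OF x] F(3) S(3) by force
    then show False using X(2) x \<open>y \<in> Y\<close> \<open>y \<noteq> x\<close> Y(1) by blast
  qed
  ultimately show ?thesis using that by blast
qed

section \<open>Strictness of the upper inclusion: simultaneous Diophantine approximation\<close>

text \<open>Enumerating \<open>D\<close> gives access to the indexed form of Dirichlet's theorem;
  its numerators \<open>p i\<close> disappear into the distance to the integers. The explicit bound
  on \<open>q\<close> is later weighed against the decay of \<open>r\<close>.\<close>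

lemma Dirichlet_torus:
  fixes D :: "real set"
  assumes "finite D" "N > 0"
  obtains q :: nat where "q > 0" "q \<le> N ^ card D" "\<And>d. d \<in> D \<Longrightarrow> torus_norm (d * real q) < 1 / N"
proof -
  obtain f where f: "bij_betw f {0..<card D} D"
    using ex_bij_betw_nat_finite[OF assms(1)] by blast
  obtain q p where q: "0 < q" "q \<le> int (N ^ card D)"
    "\<And>i. i < card D \<Longrightarrow> \<bar>of_int q * f i - of_int (p i)\<bar> < 1 / N"
    using Dirichlet_approx_simult[OF assms(2), of "card D" f] by metis
  have "torus_norm (d * real (nat q)) < 1 / N" if d: "d \<in> D" for d
  proof -
    obtain i where "i < card D" "d = f i" using bij_betw_imp_surj_on[OF f] d by (metis atLeastLessThan_iff imageE)
    then show ?thesis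
      using q(1) q(3)[of i] torus_norm_le_abs[of "of_int (p i)" "d * real (nat q)"]
      by (simp add: mult.commute)
  qed
  moreover have "nat q > 0" "nat q \<le> N ^ card D" using q(1,2) by (simp_all only: zero_less_nat_eq nat_le_iff)
  ultimately show ?thesis using that by blast
qed

text \<open>The bound on \<open>q\<close> grows exponentially in \<open>L\<close>, at a rate fixed
  by \<open>card A\<close> and \<open>N\<close>. These can be arbitrarily large, so in this argument
  no fixed exponential decay of \<open>r\<close> would cover all neighbourhoods; superexponential
  decay does.\<close>

lemma U_nbhd_contains_positive_integer:
  assumes pos: "\<And>n. n \<ge> 1 \<Longrightarrow> r n > 0"
    and decay: "filterlim (\<lambda>n. - ln (r n) / real n) at_top sequentially"
    and A: "finite A" "A \<noteq> {}" "\<epsilon> > 0"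
  obtains q :: nat where "q > 0" "real q \<in> U_nbhd r A \<epsilon>"
proof -
  obtain N :: nat where N: "N > 0" "1 / real N < \<epsilon>/2"
    using A(3) by (metis nat_approx_posE half_gt_zero zero_less_Suc)
  obtain M where M: "M > 0" "\<And>a. a \<in> A \<Longrightarrow> \<bar>a\<bar> \<le> M" using finite_abs_bound[OF A(1)] by blast
  \<comment> \<open>The first summand is the exponential rate of the bound
    \<open>N ^ (card A * L)\<close>; the extra 1 leaves a factor \<open>exp (- real n)\<close> to
    absorb \<open>M\<close>. There is no circularity, as \<open>C\<close> is fixed before
    \<open>L\<close>.\<close>
  define C where "C = card A * ln N + 1"
  have "eventually (\<lambda>n. C \<le> - ln (r n) / real n) sequentially"
    using decay by (simp add: filterlim_at_top)
  moreover have "(\<lambda>n. M * exp (- real n)) \<longlonglongrightarrow> 0" by real_asymp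
  then have "eventually (\<lambda>n. M * exp (- real n) < \<epsilon>/2) sequentially"
    using A(3) by (intro order_tendstoD(2)) auto
  ultimately have "eventually (\<lambda>n. C \<le> - ln (r n) / real n \<and> M * exp (- real n) < \<epsilon>/2) sequentially"
    by (rule eventually_conj)
  then obtain L where L: "\<And>n. n \<ge> L \<Longrightarrow> C \<le> - ln (r n) / real n \<and> M * exp (- real n) < \<epsilon>/2"
    unfolding eventually_sequentially by blast
  define D where "D = (\<lambda>(a, n). a * r n) ` (A \<times> {1..L})"
  have "finite D" using A(1) by (simp add: D_def)
  then obtain q :: nat where q: "q > 0" "q \<le> N ^ card D" "\<And>d. d \<in> D \<Longrightarrow> torus_norm (d * real q) < 1 / N"
    using Dirichlet_torus N(1) by blast
  \<comment> \<open>Products \<open>a * r n\<close> from different pairs may coincide, hence only an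
    inequality.\<close>
  have "card D \<le> card A * L"
    unfolding D_def using card_image_le[of "A \<times> {1..L}"] A(1) by (fastforce simp: card_cartesian_product)
  then have "N ^ card D \<le> N ^ (card A * L)" using N(1) by (intro power_increasing) auto
  then have "real q \<le> real N ^ (card A * L)"
    using q(2) by (metis le_trans of_nat_le_iff of_nat_power)
  also have "\<dots> = exp (card A * L * ln N)"
    using N(1) by (simp add: exp_of_nat_mult flip: of_nat_mult)
  finally have q_le: "real q \<le> exp (card A * L * ln N)" .
  have "p_seminorm r A q \<le> \<epsilon>/2"
  proof (rule p_seminorm_least[OF A(2)])
    fix a and n :: nat assume an: "a \<in> A" "n \<ge> 1"
    show "torus_norm (a * r n * real q) \<le> \<epsilon>/2"
    proof (cases "n \<le> L")
      case True
      then have "a * r n \<in> D" using an by (auto simp: D_def)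
      from q(3)[OF this] show ?thesis using N(2) by simp
    next
      case False
      then have "C * real n \<le> - ln (r n)" using L[of n] an(2) by (simp add: field_simps)
      then have "ln (r n) \<le> - C * real n" by simp
      then have r_le: "r n \<le> exp (- C * real n)" using pos[OF an(2)] by (metis exp_le_cancel_iff exp_ln)
      \<comment> \<open>Enlarging \<open>L\<close> to \<open>n\<close> is harmless since
        \<open>ln N\<close> is nonnegative, and makes the term cancel the first summand of
        \<open>C\<close> times \<open>n\<close>.\<close>
      have "card A * L * ln N \<le> card A * n * ln N"
        using False N(1) by (intro mult_right_mono) (auto intro!: mult_left_mono)
      then have "- C * real n + card A * L * ln N \<le> - real n"
        by (simp add: C_def algebra_simps)
      then have "exp (- C * real n) * exp (card A * L * ln N) \<le> exp (- real n)"
        unfolding exp_add[symmetric] by simp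
      then have "r n * real q \<le> exp (- real n)"
        using mult_mono[OF r_le q_le] by simp
      then have "\<bar>a\<bar> * (r n * real q) \<le> M * exp (- real n)"
        using M(1) M(2)[OF an(1)] pos[OF an(2)] by (intro mult_mono) auto
      then show ?thesis
        using torus_norm_le_abs_self[of "a * r n * real q"] L[of n] False pos[OF an(2)]
        by (simp add: abs_mult mult.assoc)
    qed
  qed
  then have "real q \<in> U_nbhd r A \<epsilon>" using A(3) by (simp add: U_nbhd_def)
  then show ?thesis using that q(1) by blast
qed

section \<open>Convergence of the sequence and assembly of the result\<close>

text \<open>Eventually the quotient is at least 1, so \<open>r n\<close> is dominated by
  \<open>exp (- real n)\<close>. The inclusion in the usual topology and the strictness over
  \<open>t\<close> use the decay in this weak form.\<close>

lemma superexponential_decay_imp_tendsto_0: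
  fixes r :: "nat \<Rightarrow> real"
  assumes pos: "\<And>n. n \<ge> 1 \<Longrightarrow> r n > 0"
    and decay: "filterlim (\<lambda>n. - ln (r n) / real n) at_top sequentially"
  shows "r \<longlonglongrightarrow> 0"
proof (rule tendsto_sandwich[where f = "\<lambda>_. 0"])
  show "(\<lambda>n. exp (- real n)) \<longlonglongrightarrow> 0" by real_asymp
  show "eventually (\<lambda>n. 0 \<le> r n) sequentially"
    using eventually_ge_at_top[of 1] by eventually_elim (use pos in force)
  have "eventually (\<lambda>n. 1 \<le> - ln (r n) / real n) sequentially"
    using decay unfolding filterlim_at_top by blast
  then show "eventually (\<lambda>n. r n \<le> exp (- real n)) sequentially"
    using eventually_ge_at_top[of 1]
  proof eventually_elim
    case (elim n)
    then have "ln (r n) \<le> - real n" by (simp add: field_simps)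
    then show ?case using pos[OF elim(2)] by (metis exp_le_cancel_iff exp_ln)
  qed
qed simp

theorem theorem1p1:
  fixes r :: "nat \<Rightarrow> real"
  assumes pos: "\<And>n. n \<ge> 1 \<Longrightarrow> r n > 0"
    and decay: "filterlim (\<lambda>n. - ln (r n) / real n) at_top sequentially"
  shows "Hausdorff_space (sigma_topology r) \<and> TVG_topology (sigma_topology r) \<and>
    {S. openin t_topology S} \<subset> {S. openin (sigma_topology r) S} \<and>
    {S. openin (sigma_topology r) S} \<subset> {S. openin (euclidean :: real topology) S}"
proof (intro conjI)
  have lim: "r \<longlonglongrightarrow> 0" using superexponential_decay_imp_tendsto_0 pos decay by blast
  have r1: "r 1 > 0" using pos by simp
  show "Hausdorff_space (sigma_topology r)" using Hausdorff_sigma_topology[of 1] r1 by simp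
  show "TVG_topology (sigma_topology r)" by (rule TVG_sigma_topology)
  obtain S where "openin (sigma_topology r) S" "\<not> openin t_topology S"
    using sigma_topology_not_coarser_t[of r] pos lim by blast
  then show "{S. openin t_topology S} \<subset> {S. openin (sigma_topology r) S}"
    using t_topology_coarser_sigma[of 1 r] r1 by auto
  have "\<not> openin (sigma_topology r) {-1<..<1}"
  proof
    assume "openin (sigma_topology r) {-1<..<1}"
    then obtain A \<epsilon> where A: "finite A" "A \<noteq> {}" "\<epsilon> > 0" "(+) 0 ` U_nbhd r A \<epsilon> \<subseteq> {-1<..<1}"
      by (rule openin_sigma_topologyE[of r _ 0]) auto
    obtain q :: nat where "q > 0" "real q \<in> U_nbhd r A \<epsilon>"
      using U_nbhd_contains_positive_integer[of r A \<epsilon>] pos decay A(1-3) by blast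
    then show False using A(4) by force
  qed
  moreover have "openin euclidean {-1<..<1::real}" by simp
  ultimately show "{S. openin (sigma_topology r) S} \<subset> {S. openin euclidean S}"
    using sigma_topology_coarser_euclidean[OF lim] by auto
qed

end
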